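(* Let $V$ be a subgroup of $\mathcal{L}_n$ with triple $(s,V_0,v)$. Then $V$ is normal in $\mathcal{L}_n$ if and only if $xV_0=V_0$, $(1-x^s)\mathcal{A}_n\subset V_0$, and $(1-x)v\in V_0$.
   Context: $p$ is a fixed prime, $n\ge 1$, $R=\mathbb{F}_p[x,x^{-1}]$, and $\mathbb{N}$ contains $0$. $\mathcal{A}_n=\bigoplus_{\mathbb{Z}}(\mathbb{Z}/p\mathbb{Z})^n$ is identified with the additive group of $R^n$, so that the shift by one on $\mathcal{A}_n$ is multiplication by $x$. $\mathcal{L}_n=(\mathbb{Z}/p\mathbb{Z})^n\wr\mathbb{Z}=\mathcal{A}_n\rtimes\mathbb{Z}$, with elements written $(v,s)$ and multiplication $(v,s)(w,t)=(v+x^sw,s+t)$; $\mathcal{A}_n$ is identified with $\{(v,0)\}$. The triple $(s,V_0,v)$ of a subgroup $V\le\mathcal{L}_n$: $s\in\mathbb{N}$ is such that $s\mathbb{Z}$ is the image of $V$ under the projection to $\mathbb{Z}$, $V_0=V\cap\mathcal{A}_n$ (it satisfies $x^sV_0=V_0$), and $v\in\mathcal{A}_n$ is any element with $(v,s)\in V$ (well defined modulo $V_0$; for $s=0$ one takes $v=0$). *)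

theory Defs
  imports
    "HOL-Analysis.Finite_Cartesian_Product"
    "HOL-Library.Poly_Mapping"
    "HOL-Algebra.Coset"
    "Berlekamp_Zassenhaus.Finite_Field"
begin

text \<open>
  The prime \<open>p\<close> is \<open>CARD('p)\<close> for a type \<open>'p\<close> of class \<^class>\<open>prime_card\<close>, and the rank
  \<open>n \<ge> 1\<close> is \<open>CARD('n)\<close> for a finite type \<open>'n\<close>.  The Laurent polynomial ring
  \<open>F\<^sub>p[x, x\<^sup>-\<^sup>1]\<close> is the group ring of the additive group \<^typ>\<open>int\<close> over \<open>F\<^sub>p\<close>: finitely supported
  functions on \<^typ>\<open>int\<close>, multiplied by convolution.
\<close>

type_synonym 'p laurent = "int \<Rightarrow>\<^sub>0 'p mod_ring"

type_synonym ('p, 'n) base = "('p laurent, 'n) vec"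

definition lx :: "'p::prime_card laurent" where
  "lx = Poly_Mapping.single 1 1"

text \<open>
  Integer powers of \<open>x\<close>, written as monomials since \<open>powi\<close> is unavailable in a ring that is
  not a division ring; see \<open>lxpow_int\<close> and \<open>lxpow_uminus\<close> below.
\<close>

definition lxpow :: "int \<Rightarrow> 'p::prime_card laurent" where
  "lxpow k = Poly_Mapping.single k 1"

definition lamplighter :: "(('p::prime_card, 'n::finite) base \<times> int) monoid" where
  "lamplighter =
     \<lparr>carrier = UNIV,
      monoid.mult = (\<lambda>(v, s) (w, t). (v + lxpow s *s w, s + t)),
      monoid.one = (0, 0)\<rparr>"

text \<open>
  Under the identification of the base group with \<open>{(v, 0)}\<close>, the component \<open>V0\<close> is recorded
  as a subset of the base group itself.
\<close>

definition is_triple ::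
  "(('p::prime_card, 'n::finite) base \<times> int) set \<Rightarrow> nat \<Rightarrow> ('p, 'n) base set \<Rightarrow> ('p, 'n) base \<Rightarrow> bool"
where
  "is_triple V s V0 v \<longleftrightarrow>
     snd ` V = range (\<lambda>k. int s * k) \<and>
     V0 = {a. (a, 0) \<in> V} \<and>
     (v, int s) \<in> V \<and>
     (s = 0 \<longrightarrow> v = 0)"

lemma lxpow_0: "lxpow 0 = 1"
  by (simp add: lxpow_def)

lemma lxpow_add: "lxpow (j + k) = lxpow j * lxpow k"
  by (simp add: lxpow_def mult_single)

lemma lxpow_int: "lxpow (int m) = (lx :: 'p::prime_card laurent) ^ m"
proof (induction m)
  case (Suc m)
  have "lxpow (int (Suc m)) = lxpow 1 * (lxpow (int m) :: 'p laurent)"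
    by (simp flip: lxpow_add)
  then show ?case
    using Suc by (simp add: lx_def lxpow_def)
qed (simp add: lxpow_0)

lemma lxpow_uminus: "lxpow (- k) * lxpow k = 1"
  by (simp flip: lxpow_add add: lxpow_0)

lemma group_lamplighter: "group lamplighter"
proof (rule groupI)
  fix g :: "('a, 'b) base \<times> int"
  obtain v s where g: "g = (v, s)" by force
  have "(- (lxpow (- s) *s v), - s) \<otimes>\<^bsub>lamplighter\<^esub> g = \<one>\<^bsub>lamplighter\<^esub>"
    by (simp add: g lamplighter_def)
  then show "\<exists>h\<in>carrier lamplighter. h \<otimes>\<^bsub>lamplighter\<^esub> g = \<one>\<^bsub>lamplighter\<^esub>"
    by (rule bexI) (simp add: lamplighter_def)
qed (auto simp: lamplighter_def lxpow_0 lxpow_add vector_add_ldistrib vector_smult_assoc)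

end

theory Submission
  imports Defs
begin

text \<open>
  Conjugating \<open>(w, t)\<close> by \<open>(a, m)\<close> gives \<open>(x\<^sup>m w + (1 - x\<^sup>t) a, t)\<close>.  Taking \<open>(w, t)\<close> in \<open>V\<^sub>0\<close> or
  equal to \<open>(v, s)\<close>, and \<open>(a, m)\<close> equal to \<open>(0, \<plusminus>1)\<close> or \<open>(a, 0)\<close>, shows that the three conditions
  are necessary.  Conversely they give \<open>(x\<^sup>m - 1) v \<in> V\<^sub>0\<close> for every \<open>m\<close>, so that every conjugate
  of \<open>(v, s)\<close> and of an element of \<open>V\<^sub>0\<close> lies in \<open>V\<close>; and these elements generate \<open>V\<close>.
\<close>

lemma carrier_lamplighter [simp]: "carrier lamplighter = UNIV"
  by (simp add: lamplighter_def)

lemma mult_lamplighter [simp]: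
  "(v, s) \<otimes>\<^bsub>lamplighter\<^esub> (w, t) = (v + lxpow s *s w, s + t)"
  by (simp add: lamplighter_def)

lemma one_lamplighter: "\<one>\<^bsub>lamplighter\<^esub> = (0, 0)"
  by (simp add: lamplighter_def)

lemma inv_lamplighter [simp]:
  "inv\<^bsub>lamplighter\<^esub> (v, s) = (- (lxpow (- s) *s v), - s)"
proof -
  interpret group lamplighter by (rule group_lamplighter)
  show ?thesis
    by (rule inv_equality) (simp_all add: one_lamplighter)
qed

lemma conj_lamplighter:
  "(a, m) \<otimes>\<^bsub>lamplighter\<^esub> (w, t) \<otimes>\<^bsub>lamplighter\<^esub> inv\<^bsub>lamplighter\<^esub> (a, m)
    = (lxpow m *s w + (1 - lxpow t) *s a, t)"
  by (simp add: vector_smult_assoc vector_smult_rneg vector_sub_rdistrib flip: lxpow_add)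

lemma lxpow_1: "lxpow 1 = lx"
  by (simp add: lxpow_def lx_def)

theorem lemma3p2:
  fixes V :: "(('p::prime_card, 'n::finite) base \<times> int) set"
    and s :: nat
    and V0 :: "('p, 'n) base set"
    and v :: "('p, 'n) base"
  assumes "subgroup V lamplighter"
    and "is_triple V s V0 v"
  shows "V \<lhd> lamplighter \<longleftrightarrow>
           (\<lambda>a. lx *s a) ` V0 = V0 \<and>
           range (\<lambda>a. (1 - lx ^ s) *s a) \<subseteq> V0 \<and>
           (1 - lx) *s v \<in> V0"
    (is "_ \<longleftrightarrow> ?shift \<and> ?range \<and> ?v")
proof -
  interpret group "lamplighter :: (('p, 'n) base \<times> int) monoid" by (rule group_lamplighter)
  interpret V: subgroup V lamplighter by (rule assms)
  \<comment> \<open>Rewriting \<open>lx ^ m\<close> as a monomial gives natural and integer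
    exponents one normal form.\<close>
  note lxpow_int [symmetric, simp] lxpow_0 [simp]
  have V0: "a \<in> V0 \<longleftrightarrow> (a, 0) \<in> V" for a
    using assms(2) by (auto simp: is_triple_def)
  have vs: "(v, int s) \<in> V" and snd_V: "snd ` V = range (\<lambda>k. int s * k)"
    using assms(2) by (auto simp: is_triple_def)
  \<comment> \<open>The fibre of \<open>V\<close> over t is a coset of \<open>V0\<close>, because
    \<open>(u + w, t)\<close> times the inverse of \<open>(w, t)\<close> is
    \<open>(u, 0)\<close>.\<close>
  have coset: "(u + w, t) \<in> V \<longleftrightarrow> u \<in> V0" if "(w, t) \<in> V" for u w t
  proof
    assume "(u + w, t) \<in> V"
    then have "(u + w, t) \<otimes>\<^bsub>lamplighter\<^esub> inv\<^bsub>lamplighter\<^esub> (w, t) \<in> V"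
      using that by (intro V.m_closed V.m_inv_closed)
    then show "u \<in> V0"
      by (simp add: V0 vector_smult_assoc vector_smult_rneg flip: lxpow_add)
  next
    assume "u \<in> V0"
    then show "(u + w, t) \<in> V"
      using V.m_closed [of "(u, 0)" "(w, t)"] that by (simp add: V0)
  qed
  have V0_add: "a + b \<in> V0" if "a \<in> V0" "b \<in> V0" for a b
    using that coset [of b 0 a] by (simp add: V0)
  show ?thesis
  proof
    assume "V \<lhd> lamplighter"
    then have conj: "(lxpow m *s w + (1 - lxpow t) *s a, t) \<in> V" if "(w, t) \<in> V" for a m w t
      using that normal.inv_op_closed2 [of V lamplighter "(a, m)" "(w, t)"]
      by (simp only: conj_lamplighter) simp
    have shift: "lxpow m *s a \<in> V0" if "a \<in> V0" for m a
      using conj [of a 0 m 0] that by (simp add: V0)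
    \<comment> \<open>The harder inclusion in \<open>?shift\<close>: the preimage of a is its
      conjugate by \<open>(0, -1)\<close>.\<close>
    have "a \<in> (\<lambda>a. lx *s a) ` V0" if "a \<in> V0" for a
    proof (rule image_eqI)
      show "a = lx *s (lxpow (- 1) *s a)"
        by (simp add: vector_smult_assoc flip: lxpow_add lxpow_1)
    qed (rule shift [OF that])
    \<comment> \<open>Conjugating \<open>(v, int s)\<close> by \<open>(a, 0)\<close> stays in its
      fibre and changes the first entry by exactly this vector.\<close>
    moreover have "(1 - lx ^ s) *s a \<in> V0" for a
      using conj [OF vs, of 0 a] coset [OF vs, of "(1 - lx ^ s) *s a"] by (simp add: add.commute)
    \<comment> \<open>Both \<open>(v, int s)\<close> and its conjugate by \<open>(0, 1)\<close> lie
      over s, so their first entries differ by an element of \<open>V0\<close>.\<close>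
    moreover have "(1 - lx) *s v \<in> V0"
    proof -
      have "((1 - lx) *s v + lxpow 1 *s v, int s) \<in> V"
        using vs by (simp add: lxpow_1 vector_sub_rdistrib)
      moreover have "(lxpow 1 *s v, int s) \<in> V"
        using conj [OF vs, of 1 0] by simp
      ultimately show ?thesis
        using coset by blast
    qed
    ultimately show "?shift \<and> ?range \<and> ?v"
      using shift [of _ 1] by (auto simp: lxpow_1)
  next
    assume conds: "?shift \<and> ?range \<and> ?v"
    have V0_uminus: "- a \<in> V0" if "a \<in> V0" for a
      using V.m_inv_closed [of "(a, 0)"] that by (simp add: V0)
    have up: "lxpow 1 *s a \<in> V0" if "a \<in> V0" for a
      using conds that by (auto simp: lxpow_1)
    \<comment> \<open>This needs equality in \<open>?shift\<close>: a is x times some b in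
      \<open>V0\<close>, and cancelling x leaves b.\<close>
    have down: "lxpow (- 1) *s a \<in> V0" if a: "a \<in> V0" for a
    proof -
      obtain b where "b \<in> V0" "a = lxpow 1 *s b"
        using a conds by (metis (no_types, lifting) imageE lxpow_1)
      then show ?thesis
        by (simp add: vector_smult_assoc flip: lxpow_add)
    qed
    have shift: "lxpow m *s a \<in> V0" if "a \<in> V0" for m a
    proof (induction m rule: int_induct [where k = 0])
      case (step1 m)
      then show ?case
        using up [of "lxpow m *s a"] by (simp add: vector_smult_assoc add.commute flip: lxpow_add)
    next
      case (step2 m)
      then show ?case
        using down [of "lxpow m *s a"] by (simp add: vector_smult_assoc flip: lxpow_add)
    qed (simp add: that)
    have v1: "(lxpow 1 - 1) *s v \<in> V0"
      using V0_uminus [of "(1 - lx) *s v"] conds by (simp add: lxpow_1 vector_sub_rdistrib)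
    \<comment> \<open>Telescoping: consecutive values differ by a power of x times
      \<open>(lxpow 1 - 1) *s v\<close>, which \<open>shift\<close> keeps in
      \<open>V0\<close>.\<close>
    have v: "(lxpow m - 1) *s v \<in> V0" for m
    proof (induction m rule: int_induct [where k = 0])
      case base
      show ?case using V.one_closed by (simp add: V0 one_lamplighter)
    next
      case (step1 m)
      have "(lxpow (m + 1) - 1) *s v = (lxpow m - 1) *s v + lxpow m *s ((lxpow 1 - 1) *s v)"
        by (simp add: vector_smult_assoc vector_sub_rdistrib vector_ssub_ldistrib algebra_simps flip: lxpow_add)
      then show ?case
        using V0_add [OF step1(2) shift [OF v1]] by simp
    next
      case (step2 m)
      have "(lxpow (m - 1) - 1) *s v
          = (lxpow m - 1) *s v + - (lxpow (m - 1) *s ((lxpow 1 - 1) *s v))"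
        by (simp add: vector_smult_assoc vector_sub_rdistrib vector_ssub_ldistrib algebra_simps flip: lxpow_add)
      then show ?case
        using V0_add [OF step2(2) V0_uminus [OF shift [OF v1]]] by simp
    qed
    have "g \<otimes>\<^bsub>lamplighter\<^esub> h \<otimes>\<^bsub>lamplighter\<^esub> inv\<^bsub>lamplighter\<^esub> g \<in> V" (is "?c g h \<in> V")
      if "h \<in> V" for g h
    proof -
      obtain a m where g: "g = (a, m)" by force
      \<comment> \<open>Conjugation by a fixed g is a homomorphism, so the factors of an element of
        \<open>V\<close> can be treated separately.\<close>
      have c_mult: "?c g (h \<otimes>\<^bsub>lamplighter\<^esub> h') = ?c g h \<otimes>\<^bsub>lamplighter\<^esub> ?c g h'" for h h'
        by (simp add: m_assoc inv_solve_left)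
      have c_inv: "?c g (inv\<^bsub>lamplighter\<^esub> h) = inv\<^bsub>lamplighter\<^esub> (?c g h)" for h
        by (simp add: inv_mult_group m_assoc)
      \<comment> \<open>The first entry of the conjugate of \<open>(v, int s)\<close> is split as an
        element of \<open>V0\<close> plus v, the shape that \<open>coset\<close> requires.\<close>
      have "((lxpow m - 1) *s v + (1 - lx ^ s) *s a) + v
          = lxpow m *s v + (1 - lxpow (int s)) *s a"
        by (simp add: vector_sub_rdistrib)
      moreover have "(lxpow m - 1) *s v + (1 - lx ^ s) *s a \<in> V0"
        using conds v by (intro V0_add) auto
      ultimately have c_vs: "?c g (v, int s) \<in> V"
        using coset [OF vs] by (metis g conj_lamplighter)
      \<comment> \<open>Induction on k strips off copies of \<open>(v, int s)\<close> until an
        element of \<open>V0\<close> remains. It also covers s = 0, where every k gives the fibre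
        over 0.\<close>
      have "?c g (w, int s * k) \<in> V" if "(w, int s * k) \<in> V" for w k
        using that
      proof (induction k arbitrary: w rule: int_induct [where k = 0])
        case base
        then show ?case
          unfolding g conj_lamplighter using shift [of w m] by (simp add: V0)
      next
        case (step1 k)
        \<comment> \<open>The witness is the first entry after dividing by \<open>(v, int s)\<close>
          on the left.\<close>
        obtain w' where w': "inv\<^bsub>lamplighter\<^esub> (v, int s) \<otimes>\<^bsub>lamplighter\<^esub> (w, int s * (k + 1)) = (w', int s * k)"
          by (rule that [of "lxpow (- int s) *s (w - v)"]) (simp add: algebra_simps vector_ssub_ldistrib)
        then have "(w', int s * k) \<in> V"
          using V.m_closed [OF V.m_inv_closed [OF vs] step1(3)] by metis
        moreover have "(w, int s * (k + 1)) = (v, int s) \<otimes>\<^bsub>lamplighter\<^esub> (w', int s * k)"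
          by (metis w' inv_solve_left UNIV_I carrier_lamplighter)
        ultimately show ?case
          using V.m_closed [OF c_vs step1(2)] c_mult by metis
      next
        case (step2 k)
        \<comment> \<open>For negative k, multiplying by \<open>(v, int s)\<close> moves towards 0;
          its inverse is then the factor to conjugate.\<close>
        obtain w' where w': "(v, int s) \<otimes>\<^bsub>lamplighter\<^esub> (w, int s * (k - 1)) = (w', int s * k)"
          by (simp add: algebra_simps)
        then have "(w', int s * k) \<in> V"
          using V.m_closed [OF vs step2(3)] by metis
        moreover have "(w, int s * (k - 1)) = inv\<^bsub>lamplighter\<^esub> (v, int s) \<otimes>\<^bsub>lamplighter\<^esub> (w', int s * k)"
          by (metis w' inv_solve_left UNIV_I carrier_lamplighter)
        ultimately show ?case
          using V.m_closed [OF V.m_inv_closed [OF c_vs] step2(2)] c_mult c_inv by metis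
      qed
      moreover obtain w k where "h = (w, int s * k)"
        using \<open>h \<in> V\<close> snd_V by (metis imageE image_eqI prod.collapse)
      ultimately show ?thesis
        using \<open>h \<in> V\<close> by blast
    qed
    then show "V \<lhd> lamplighter"
      using assms(1) by (simp add: normal_inv_iff del: mult_lamplighter inv_lamplighter)
  qed
qed

end
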